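(* Let $f:\mathbb{R}^n\to(-\infty,+\infty]$ and $g:\mathbb{R}^m\to(-\infty,+\infty]$ be proper, closed and convex, with $f$ $\sigma$-strongly convex for some $\sigma>0$, and let $\mathbf{A}$ be a real $m\times n$ matrix. Assume that $g$ is subdifferentiable at every $\mathbf{z}\in\mathbb{R}^m$ and that its subgradients are bounded: $\gamma_g:=\sup_{\mathbf{z}\in\mathbb{R}^m}\sup_{\mathbf{d}\in\partial g(\mathbf{z})}\|\mathbf{d}\|<\infty$. Then for any $\mathbf{y}\in\mathbb{R}^m$ and $L>0$, $$H\big(\mathbf{x}(p_L(\mathbf{y}))\big)-q(p_L(\mathbf{y})) \le (L+L_F)\,\big(\|p_L(\mathbf{y})\|+\gamma_g\big)\,\|p_L(\mathbf{y})-\mathbf{y}\|.$$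
   Context: $H(\mathbf{x}):=f(\mathbf{x})+g(\mathbf{A}\mathbf{x})$. Convex conjugates: $f^*(\mathbf{u})=\sup_{\mathbf{x}}\{\langle\mathbf{u},\mathbf{x}\rangle-f(\mathbf{x})\}$, $g^*(\mathbf{y})=\sup_{\mathbf{z}}\{\langle\mathbf{y},\mathbf{z}\rangle-g(\mathbf{z})\}$. Put $F(\mathbf{y}):=f^*(\mathbf{A}^\top\mathbf{y})$ (differentiable, with gradient Lipschitz with constant $L_F:=\|\mathbf{A}\|^2/\sigma$) and $G(\mathbf{y}):=g^*(-\mathbf{y})$. The dual function is $q(\mathbf{y}):=\inf_{\mathbf{x},\mathbf{z}}\{f(\mathbf{x})+g(\mathbf{z})-\langle\mathbf{y},\mathbf{A}\mathbf{x}-\mathbf{z}\rangle\}=-F(\mathbf{y})-G(\mathbf{y})$. For $L>0$, $$p_L(\mathbf{y}) := \operatorname{argmin}_{\mathbf{u}\in\mathbb{R}^m}\Big\{F(\mathbf{y})+\langle\mathbf{u}-\mathbf{y},\nabla F(\mathbf{y})\rangle+\tfrac{L}{2}\|\mathbf{u}-\mathbf{y}\|^2+G(\mathbf{u})\Big\}.$$ For $\mathbf{y}\in\mathbb{R}^m$, $\mathbf{x}(\mathbf{y}):=\operatorname{argmax}_{\mathbf{x}}\{\langle\mathbf{A}^\top\mathbf{y},\mathbf{x}\rangle-f(\mathbf{x})\}$ (unique by strong convexity). $\|\cdot\|$ is the Euclidean norm on vectors and $\|\mathbf{A}\|$ the operator norm. *)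

theory Defs
  imports "HOL-Analysis.Analysis"
begin

text \<open>Extended real functions take values in type ereal; values in \<open>(-\<infinity>, +\<infinity>]\<close> are enforced by
  properness.\<close>

definition eproper :: "('a \<Rightarrow> ereal) \<Rightarrow> bool" where
  "eproper f \<longleftrightarrow> (\<forall>x. f x \<noteq> -\<infinity>) \<and> (\<exists>x. f x \<noteq> \<infinity>)"

definition eepigraph :: "('a \<Rightarrow> ereal) \<Rightarrow> ('a \<times> real) set" where
  "eepigraph f = {(x, t). f x \<le> ereal t}"

definition eclosed :: "('a::topological_space \<Rightarrow> ereal) \<Rightarrow> bool" where
  "eclosed f \<longleftrightarrow> closed (eepigraph f)"

definition econvex :: "('a::real_vector \<Rightarrow> ereal) \<Rightarrow> bool" where
  "econvex f \<longleftrightarrow> convex (eepigraph f)"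

text \<open>For proper \<open>f\<close> the right-hand side below is never of the form \<open>\<infinity> - \<infinity>\<close>; at \<open>t = 0\<close> and \<open>t = 1\<close>
  the ereal convention \<open>0 * \<infinity> = 0\<close> makes the inequality trivial.\<close>

definition strongly_econvex :: "real \<Rightarrow> ('a::real_normed_vector \<Rightarrow> ereal) \<Rightarrow> bool" where
  "strongly_econvex \<sigma> f \<longleftrightarrow> (\<forall>x y. \<forall>t\<in>{0..1}.
     f (t *\<^sub>R x + (1 - t) *\<^sub>R y)
       \<le> ereal t * f x + ereal (1 - t) * f y - ereal (\<sigma> / 2 * t * (1 - t) * (norm (x - y))\<^sup>2))"

definition conjugate :: "('a::real_inner \<Rightarrow> ereal) \<Rightarrow> 'a \<Rightarrow> ereal" where
  "conjugate f u = (SUP x. ereal (u \<bullet> x) - f x)"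

text \<open>For proper \<open>g\<close> this is empty wherever \<open>g z = \<infinity>\<close>, as usual.\<close>

definition subdiff :: "('a::real_inner \<Rightarrow> ereal) \<Rightarrow> 'a \<Rightarrow> 'a set" where
  "subdiff g z = {d. \<forall>w. g w \<ge> g z + ereal (d \<bullet> (w - z))}"

definition subgrad_bound :: "('a::real_inner \<Rightarrow> ereal) \<Rightarrow> ereal" where
  "subgrad_bound g = (SUP z. SUP d\<in>subdiff g z. ereal (norm d))"

definition gradient :: "('a::real_inner \<Rightarrow> real) \<Rightarrow> 'a \<Rightarrow> 'a" where
  "gradient h x = (THE D. GDERIV h x :> D)"

definition primal_obj ::
    "(real^'n \<Rightarrow> ereal) \<Rightarrow> (real^'m \<Rightarrow> ereal) \<Rightarrow> real^'n^'m \<Rightarrow> real^'n \<Rightarrow> ereal" where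
  "primal_obj f g A x = f x + g (A *v x)"

definition dual_obj ::
    "(real^'n \<Rightarrow> ereal) \<Rightarrow> (real^'m \<Rightarrow> ereal) \<Rightarrow> real^'n^'m \<Rightarrow> real^'m \<Rightarrow> ereal" where
  "dual_obj f g A y = (INF x. INF z. f x + g z - ereal (y \<bullet> (A *v x - z)))"

definition dual_F :: "(real^'n \<Rightarrow> ereal) \<Rightarrow> real^'n^'m \<Rightarrow> real^'m \<Rightarrow> ereal" where
  "dual_F f A y = conjugate f (transpose A *v y)"

definition dual_G :: "(real^'m \<Rightarrow> ereal) \<Rightarrow> real^'m \<Rightarrow> ereal" where
  "dual_G g y = conjugate g (- y)"

definition lipschitz_F :: "real \<Rightarrow> real^'n^'m \<Rightarrow> real" where
  "lipschitz_F \<sigma> A = (onorm (\<lambda>x. A *v x))\<^sup>2 / \<sigma>"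

text \<open>\<open>dual_F f A\<close> is finite everywhere when \<open>f\<close> is proper, closed and strongly convex, so
  \<open>real_of_ereal\<close> loses nothing there. The minimizer in \<open>prox_grad_map\<close> and the maximizer in
  \<open>primal_of_dual\<close> exist and are unique for the data of interest, so the choice made by \<open>arg_min\<close>
  and \<open>arg_max\<close> is immaterial.\<close>

definition prox_grad_map ::
    "(real^'n \<Rightarrow> ereal) \<Rightarrow> (real^'m \<Rightarrow> ereal) \<Rightarrow> real^'n^'m \<Rightarrow> real \<Rightarrow> real^'m \<Rightarrow> real^'m" where
  "prox_grad_map f g A L y = arg_min
     (\<lambda>u. dual_F f A y
        + ereal ((u - y) \<bullet> gradient (\<lambda>v. real_of_ereal (dual_F f A v)) y)
        + ereal (L / 2 * (norm (u - y))\<^sup>2)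
        + dual_G g u)
     (\<lambda>_. True)"

definition primal_of_dual :: "(real^'n \<Rightarrow> ereal) \<Rightarrow> real^'n^'m \<Rightarrow> real^'m \<Rightarrow> real^'n" where
  "primal_of_dual f A y = arg_max (\<lambda>x. ereal ((transpose A *v y) \<bullet> x) - f x) (\<lambda>_. True)"

end

theory Submission
  imports Defs
begin

text \<open>Write \<open>p = p\<^sub>L(y)\<close> and \<open>v = A x(y) + L (p - y)\<close>. Since \<open>\<nabla>F(y) = A x(y)\<close>, the optimality condition
  for \<open>p\<close> reads \<open>v \<in> \<partial>g\<^sup>*(-p)\<close>, so \<open>G(p) = -\<langle>p, v\<rangle> - g(v)\<close>. Together with
  \<open>F(p) = \<langle>p, A x(p)\<rangle> - f(x(p))\<close> the gap becomes \<open>\<langle>p, A x(p) - v\<rangle> + g(A x(p)) - g(v)\<close>, at most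
  \<open>(\<parallel>p\<parallel> + \<gamma>\<^sub>g) \<parallel>A x(p) - v\<parallel>\<close>, and \<open>\<parallel>A x(p) - A x(y)\<parallel> \<le> L\<^sub>F \<parallel>p - y\<parallel>\<close> by strong convexity.\<close>

section \<open>Perturbing extended real functions by finite-valued terms\<close>

lemma eproper_add_real:
  assumes "eproper f"
  shows "eproper (\<lambda>x. f x + ereal (q x))"
  using assms by (auto simp: eproper_def)

text \<open>The shear \<open>(x, t) \<mapsto> (x, t - q x)\<close> is continuous and pulls the
  epigraph of \<open>f\<close> back to that of the sum.\<close>

lemma eclosed_add_continuous:
  fixes f :: "'a::topological_space \<Rightarrow> ereal"
  assumes "eclosed f" and q: "continuous_on UNIV q"
  shows "eclosed (\<lambda>x. f x + ereal (q x))"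
proof -
  have *: "eepigraph (\<lambda>x. f x + ereal (q x)) = (\<lambda>(x, t). (x, t - q x)) -` eepigraph f"
  proof -
    have "f x + ereal (q x) \<le> ereal t \<longleftrightarrow> f x \<le> ereal (t - q x)" for x t
      by (cases "f x") auto
    then show ?thesis by (auto simp: eepigraph_def)
  qed
  have "continuous_on UNIV (\<lambda>p :: 'a \<times> real. q (fst p))"
    by (rule continuous_on_compose2[OF q]) (auto intro: continuous_intros)
  then have "continuous_on UNIV (\<lambda>(x, t). (x, t - q x))"
    by (auto simp: case_prod_unfold intro!: continuous_intros)
  then show ?thesis
    using assms(1) unfolding eclosed_def * by (rule closed_vimage[rotated])
qed

text \<open>Serves two purposes: tilting \<open>f\<close> by a linear term
  (\<open>\<tau> = 0\<close>), and adding the proximal quadratic with \<open>\<tau> = L\<close> to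
  the merely convex \<open>G\<close>.\<close>

lemma strongly_econvex_add:
  fixes f :: "'a::real_normed_vector \<Rightarrow> ereal" and q :: "'a \<Rightarrow> real"
  assumes f: "strongly_econvex \<sigma> f" and "eproper f"
    and q: "\<And>x y t. 0 \<le> t \<Longrightarrow> t \<le> 1 \<Longrightarrow> q (t *\<^sub>R x + (1 - t) *\<^sub>R y)
       \<le> t * q x + (1 - t) * q y - \<tau> / 2 * t * (1 - t) * (norm (x - y))\<^sup>2"
  shows "strongly_econvex (\<sigma> + \<tau>) (\<lambda>x. f x + ereal (q x))"
  unfolding strongly_econvex_def
proof (intro allI ballI)
  fix x y :: 'a and t :: real
  assume t: "t \<in> {0..1}"
  let ?z = "t *\<^sub>R x + (1 - t) *\<^sub>R y"
  have inf: "f x \<noteq> -\<infinity>" "f y \<noteq> -\<infinity>" "f ?z \<noteq> -\<infinity>"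
    using \<open>eproper f\<close> by (auto simp: eproper_def)
  have 1: "f ?z \<le> ereal t * f x + ereal (1 - t) * f y - ereal (\<sigma> / 2 * t * (1 - t) * (norm (x - y))\<^sup>2)"
    using f t unfolding strongly_econvex_def by blast
  have 2: "q ?z \<le> t * q x + (1 - t) * q y - \<tau> / 2 * t * (1 - t) * (norm (x - y))\<^sup>2"
    using q t by auto
  \<comment> \<open>At the endpoints \<open>0 * \<infinity> = 0\<close> discards one summand;
    strictly between them an infinite value at \<open>x\<close> or \<open>y\<close> makes the
    right-hand side infinite.\<close>
  consider "t = 0" | "t = 1" | "0 < t" "t < 1" using t by fastforce
  then show "f ?z + ereal (q ?z) \<le> ereal t * (f x + ereal (q x)) + ereal (1 - t) * (f y + ereal (q y))
      - ereal ((\<sigma> + \<tau>) / 2 * t * (1 - t) * (norm (x - y))\<^sup>2)"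
  proof cases
    case 3
    have split: "(\<sigma> + \<tau>) / 2 * t * (1 - t) * (norm (x - y))\<^sup>2
        = \<sigma> / 2 * t * (1 - t) * (norm (x - y))\<^sup>2 + \<tau> / 2 * t * (1 - t) * (norm (x - y))\<^sup>2"
      by (simp add: add_divide_distrib distrib_right)
    show ?thesis
    proof (cases "f x = \<infinity> \<or> f y = \<infinity>")
      case True
      then show ?thesis
        using 3 inf by (cases "f x"; cases "f y") auto
    next
      case False
      then obtain a b where ab: "f x = ereal a" "f y = ereal b"
        using inf by (cases "f x"; cases "f y") auto
      with 1 inf obtain c where c: "f ?z = ereal c"
        by (cases "f ?z") auto
      have "t * (a + q x) + (1 - t) * (b + q y) = (t * a + (1 - t) * b) + (t * q x + (1 - t) * q y)"
        by (simp add: algebra_simps)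
      then show ?thesis
        using 1 2 unfolding split by (simp add: ab c)
    qed
  qed (auto simp flip: zero_ereal_def one_ereal_def)
qed

section \<open>Existence of minimizers and quadratic growth around them\<close>

text \<open>The sublevel sets in \<open>K\<close> at real levels above the infimum form a chain of
  nonempty compact sets; a common point attains the infimum.\<close>

lemma eclosed_attains_min_on_compact:
  fixes h :: "'a::heine_borel \<Rightarrow> ereal"
  assumes "eclosed h" and "compact K" and "x0 \<in> K" and "h x0 \<noteq> \<infinity>"
  obtains x where "x \<in> K" and "\<And>y. y \<in> K \<Longrightarrow> h x \<le> h y"
proof -
  define m where "m = (INF x\<in>K. h x)"
  define S where "S = (\<lambda>t. K \<inter> {x. h x \<le> ereal t})"
  have cl: "closed {x. h x \<le> ereal t}" for t
  proof -
    have "{x. h x \<le> ereal t} = (\<lambda>x. (x, t)) -` eepigraph h"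
      by (auto simp: eepigraph_def)
    moreover have "continuous_on UNIV (\<lambda>x::'a. (x, t))"
      by (intro continuous_intros)
    ultimately show ?thesis
      using \<open>eclosed h\<close> closed_vimage by (auto simp: eclosed_def)
  qed
  have m: "m \<noteq> \<infinity>"
    using assms(3,4) INF_lower[OF assms(3), of h] by (auto simp: m_def)
  \<comment> \<open>Some real level lies above \<open>m\<close>, so the chain is nonempty and its
    common point lies in \<open>K\<close>.\<close>
  obtain t0 where t0: "m < ereal t0"
    using m ereal_dense2[of m \<infinity>] by (cases m) auto
  have "\<Inter> (S ` {t. m < ereal t}) \<noteq> {}"
  proof (rule compact_chain)
    fix T assume "T \<in> S ` {t. m < ereal t}"
    then obtain t where t: "T = S t" "m < ereal t" by auto
    show "compact T" using t cl \<open>compact K\<close> by (auto simp: S_def compact_Int_closed)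
  next
    show "{} \<notin> S ` {t. m < ereal t}"
    proof
      assume "{} \<in> S ` {t. m < ereal t}"
      then obtain t where t: "S t = {}" "m < ereal t" by auto
      then obtain x where "x \<in> K" "h x < ereal t"
        unfolding m_def INF_less_iff by auto
      then show False using t by (auto simp: S_def)
    qed
  next
    fix T U assume "T \<in> S ` {t. m < ereal t} \<and> U \<in> S ` {t. m < ereal t}"
    then obtain a b where "T = S a" "U = S b" by auto
    moreover have "S a \<subseteq> S b" if "a \<le> b" for a b
      using that by (force simp: S_def intro: order_trans)
    ultimately show "T \<subseteq> U \<or> U \<subseteq> T" by (meson linear)
  qed
  then obtain x where x: "\<And>t. m < ereal t \<Longrightarrow> x \<in> S t" by auto
  have "x \<in> K" using x[OF t0] by (auto simp: S_def)
  moreover have "h x \<le> m"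
  proof (rule ccontr)
    assume "\<not> h x \<le> m"
    then obtain t where "m < ereal t" "ereal t < h x"
      using ereal_dense2[of m "h x"] by (auto simp: not_le)
    then show False using x[of t] by (auto simp: S_def)
  qed
  moreover have "m \<le> h y" if "y \<in> K" for y
    unfolding m_def using that by (rule INF_lower)
  ultimately show ?thesis
    using that order_trans by blast
qed

text \<open>Strong convexity along the segment from \<open>x0\<close> to \<open>y\<close>, compared with the minimum over the unit ball
  around \<open>x0\<close>, forces \<open>h x0 \<le> h y\<close> for distant \<open>y\<close>; no affine minorant is needed.\<close>

lemma strongly_econvex_attains_min:
  fixes h :: "'a::euclidean_space \<Rightarrow> ereal"
  assumes "eproper h" and "eclosed h" and sc: "strongly_econvex \<sigma> h" and "\<sigma> > 0"
  obtains x where "\<And>y. h x \<le> h y"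
proof -
  have ninf: "h x \<noteq> -\<infinity>" for x using \<open>eproper h\<close> by (auto simp: eproper_def)
  obtain x0 where x0: "h x0 \<noteq> \<infinity>" using \<open>eproper h\<close> by (auto simp: eproper_def)
  then obtain c where c: "h x0 = ereal c" using ninf[of x0] by (cases "h x0") auto
  obtain x1 where x1: "\<And>y. y \<in> cball x0 1 \<Longrightarrow> h x1 \<le> h y"
    using eclosed_attains_min_on_compact[OF \<open>eclosed h\<close> compact_cball, of x0 x0 1] x0 by auto
  then obtain m where m: "h x1 = ereal m" and "m \<le> c"
    using x1[of x0] c ninf[of x1] by (cases "h x1") auto
  \<comment> \<open>Chosen so that \<open>\<sigma> / 2 * (R - 1) = c - m\<close>: beyond radius
    \<open>R\<close> the quadratic gain outweighs the largest drop of \<open>h\<close> below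
    \<open>h x0\<close> on the unit ball.\<close>
  define R where "R = 1 + 2 * (c - m) / \<sigma>"
  have "R \<ge> 1" using \<open>m \<le> c\<close> \<open>\<sigma> > 0\<close> by (simp add: R_def)
  obtain x2 where x2: "\<And>y. y \<in> cball x0 R \<Longrightarrow> h x2 \<le> h y"
    using eclosed_attains_min_on_compact[OF \<open>eclosed h\<close> compact_cball, of x0 x0 R] x0 \<open>R \<ge> 1\<close> by auto
  have "h x0 \<le> h y" if y: "y \<notin> cball x0 R" for y
  proof (cases "h y")
    case (real b)
    define r where "r = norm (y - x0)"
    have r: "r > R" "r > 1" using y \<open>R \<ge> 1\<close> by (auto simp: r_def dist_norm norm_minus_commute)
    \<comment> \<open>Puts \<open>?z\<close> at distance exactly 1 from \<open>x0\<close>, where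
      \<open>h\<close> is at least \<open>m\<close>. Multiplying by \<open>r\<close> below then
      clears \<open>t\<close>.\<close>
    define t where "t = 1 / r"
    have t: "0 \<le> t" "t \<le> 1" "t * r = 1" using r by (auto simp: t_def)
    let ?z = "t *\<^sub>R y + (1 - t) *\<^sub>R x0"
    have "dist x0 ?z = norm (t *\<^sub>R (x0 - y))"
      unfolding dist_norm by (simp add: algebra_simps)
    also have "\<dots> = 1"
      using t by (simp add: r_def norm_minus_commute)
    finally have "h x1 \<le> h ?z" by (intro x1) simp
    also have "h ?z \<le> ereal t * h y + ereal (1 - t) * h x0 - ereal (\<sigma> / 2 * t * (1 - t) * r\<^sup>2)"
      using sc t unfolding strongly_econvex_def r_def by auto
    finally have "m \<le> t * b + (1 - t) * c - \<sigma> / 2 * t * (1 - t) * r\<^sup>2"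
      by (simp add: m c real)
    then have "r * m \<le> r * (t * b + (1 - t) * c - \<sigma> / 2 * t * (1 - t) * r\<^sup>2)"
      using r by (intro mult_left_mono) auto
    also have "\<dots> = (t * r) * b + (r - t * r) * c - \<sigma> / 2 * (t * r) * (r - t * r) * r"
      by (simp add: algebra_simps power2_eq_square)
    also have "\<dots> = b + (r - 1) * c - \<sigma> / 2 * (r - 1) * r"
      using t by simp
    finally have 1: "b - c \<ge> r * (\<sigma> / 2 * (r - 1) - (c - m))"
      by (simp add: algebra_simps)
    have "\<sigma> / 2 * (r - 1) \<ge> \<sigma> / 2 * (R - 1)" using r \<open>\<sigma> > 0\<close> by simp
    moreover have "\<sigma> / 2 * (R - 1) = c - m" using \<open>\<sigma> > 0\<close> by (simp add: R_def)
    ultimately have "r * (\<sigma> / 2 * (r - 1) - (c - m)) \<ge> 0" using r by simp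
    with 1 show ?thesis by (simp add: c real)
  qed (use ninf in auto)
  moreover have "h x2 \<le> h x0" using x2 \<open>R \<ge> 1\<close> by auto
  ultimately show ?thesis using that x2 by (meson order_trans)
qed

text \<open>Minimality bounds \<open>h\<close> from below by \<open>h x\<close> at the point
  \<open>t\<close> of the way from \<open>x\<close> to \<open>z\<close>. Dividing the strong
  convexity inequality by \<open>t\<close> and letting \<open>t\<close> tend to 0 from the right
  yields the full constant \<open>\<sigma> / 2\<close>.\<close>

lemma strongly_econvex_growth:
  fixes h :: "'a::real_normed_vector \<Rightarrow> ereal"
  assumes "eproper h" and sc: "strongly_econvex \<sigma> h" and min: "\<And>y. h x \<le> h y"
  shows "h x + ereal (\<sigma> / 2 * (norm (z - x))\<^sup>2) \<le> h z"
proof (cases "h z")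
  case (real b)
  have "h x \<noteq> -\<infinity>" using \<open>eproper h\<close> by (auto simp: eproper_def)
  moreover have "h x \<le> ereal b" using min[of z] real by simp
  ultimately obtain a where a: "h x = ereal a" by (cases "h x") auto
  define k where "k = \<sigma> / 2 * (norm (z - x))\<^sup>2"
  have ev: "a + k * (1 - t) \<le> b" if t: "0 < t" "t < 1" for t
  proof -
    have "h x \<le> h (t *\<^sub>R z + (1 - t) *\<^sub>R x)" by (rule min)
    also have "\<dots> \<le> ereal t * h z + ereal (1 - t) * h x - ereal (\<sigma> / 2 * t * (1 - t) * (norm (z - x))\<^sup>2)"
      using sc t unfolding strongly_econvex_def by auto
    finally have "a \<le> t * b + (1 - t) * a - \<sigma> / 2 * t * (1 - t) * (norm (z - x))\<^sup>2"
      by (simp add: a real)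
    then have "t * (a + k * (1 - t)) \<le> t * b" by (simp add: k_def algebra_simps)
    then show ?thesis using t by simp
  qed
  have "((\<lambda>t. a + k * (1 - t)) \<longlongrightarrow> a + k * (1 - 0)) (at_right 0)"
    by (intro tendsto_intros)
  moreover have "eventually (\<lambda>t. a + k * (1 - t) \<le> b) (at_right 0)"
    using ev by (auto simp: eventually_at_right_field intro: exI[of _ 1])
  ultimately have "a + k * (1 - 0) \<le> b"
    by (intro tendsto_upperbound[of _ _ "at_right 0"]) auto
  then show ?thesis by (simp add: a real k_def)
next
  case MInf
  then show ?thesis using \<open>eproper h\<close> by (auto simp: eproper_def)
qed auto

section \<open>Convex conjugates and subgradients\<close>

lemma conjugate_ge: "ereal (u \<bullet> x) - f x \<le> conjugate f u"
  unfolding conjugate_def by (rule SUP_upper) simp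

lemma fenchel_young:
  assumes "eproper f"
  shows "ereal (u \<bullet> x) \<le> f x + conjugate f u"
proof -
  have "f x \<noteq> -\<infinity>" using assms by (auto simp: eproper_def)
  then show ?thesis
    using conjugate_ge[of u x f] by (cases "f x"; cases "conjugate f u") auto
qed

text \<open>Trades a bound on a supremum of extended differences for a family of affine minorants of
  \<open>f\<close> with real coefficients.\<close>

lemma conjugate_le_iff:
  assumes "eproper f"
  shows "conjugate f u \<le> ereal c \<longleftrightarrow> (\<forall>x. ereal (u \<bullet> x - c) \<le> f x)"
proof -
  have "ereal (u \<bullet> x) - f x \<le> ereal c \<longleftrightarrow> ereal (u \<bullet> x - c) \<le> f x" for x
    using assms by (cases "f x") (auto simp: eproper_def)
  then show ?thesis by (simp add: conjugate_def SUP_le_iff)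
qed

lemma conjugate_neq_MInf:
  assumes "eproper f"
  shows "conjugate f u \<noteq> -\<infinity>"
proof -
  obtain x where "f x \<noteq> \<infinity>" using assms by (auto simp: eproper_def)
  then show ?thesis using fenchel_young[OF assms, of u x] by (cases "f x") auto
qed

text \<open>The epigraph is an intersection over \<open>x\<close> of closed half-spaces, or of the
  whole space where \<open>f x = \<infinity>\<close>.\<close>

lemma eclosed_conjugate:
  fixes f :: "'a::real_inner \<Rightarrow> ereal"
  assumes "eproper f"
  shows "eclosed (conjugate f)"
proof -
  have "closed {p. ereal (fst p \<bullet> x - snd p) \<le> f x}" for x :: 'a
    using assms
    by (cases "f x") (auto simp: eproper_def intro!: closed_Collect_le continuous_intros)
  moreover have "eepigraph (conjugate f) = (\<Inter>x. {p. ereal (fst p \<bullet> x - snd p) \<le> f x})"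
    by (auto simp: eepigraph_def conjugate_le_iff[OF assms])
  ultimately show ?thesis by (auto simp: eclosed_def)
qed

text \<open>Modulus 0 is plain convexity in inequality form, ready for
  \<open>strongly_econvex_add\<close>. Two affine minorants of \<open>f\<close> combine convexly
  into a third.\<close>

lemma strongly_econvex_conjugate:
  fixes f :: "'a::real_inner \<Rightarrow> ereal"
  assumes "eproper f"
  shows "strongly_econvex 0 (conjugate f)"
  unfolding strongly_econvex_def
proof (intro allI ballI)
  fix u v :: 'a and t :: real
  assume t: "t \<in> {0..1}"
  let ?w = "t *\<^sub>R u + (1 - t) *\<^sub>R v"
  note ninf = conjugate_neq_MInf[OF assms]
  consider "t = 0" | "t = 1" | "0 < t" "t < 1" using t by fastforce
  then show "conjugate f ?w \<le> ereal t * conjugate f u + ereal (1 - t) * conjugate f v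
      - ereal (0 / 2 * t * (1 - t) * (norm (u - v))\<^sup>2)"
  proof cases
    case 3
    show ?thesis
    proof (cases "conjugate f u = \<infinity> \<or> conjugate f v = \<infinity>")
      case True
      then show ?thesis
        using 3 ninf[of u] ninf[of v] by (cases "conjugate f u"; cases "conjugate f v") auto
    next
      case False
      then obtain a b where ab: "conjugate f u = ereal a" "conjugate f v = ereal b"
        using ninf[of u] ninf[of v] by (cases "conjugate f u"; cases "conjugate f v") auto
      have "conjugate f ?w \<le> ereal (t * a + (1 - t) * b)"
        unfolding conjugate_le_iff[OF assms]
      proof
        fix x
        have "ereal (u \<bullet> x - a) \<le> f x" "ereal (v \<bullet> x - b) \<le> f x"
          using ab conjugate_le_iff[OF assms, of u a] conjugate_le_iff[OF assms, of v b] by simp_all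
        moreover have "t * (u \<bullet> x - a) + (1 - t) * (v \<bullet> x - b) \<le> c"
          if "u \<bullet> x - a \<le> c" "v \<bullet> x - b \<le> c" for c
          by (rule convex_bound_le) (use that 3 in auto)
        ultimately show "ereal (?w \<bullet> x - (t * a + (1 - t) * b)) \<le> f x"
          by (cases "f x") (auto simp: algebra_simps inner_add_left)
      qed
      then show ?thesis by (simp add: ab)
    qed
  qed (auto simp flip: zero_ereal_def one_ereal_def)
qed

text \<open>The case of equality in Fenchel-Young: the subgradient inequality says that
  \<open>d \<bullet> w - g w\<close> is largest at \<open>w = z\<close>.\<close>

lemma conjugate_subgradient:
  assumes "g z = ereal c" and "d \<in> subdiff g z"
  shows "conjugate g d = ereal (d \<bullet> z - c)"
proof (rule antisym)
  show "conjugate g d \<le> ereal (d \<bullet> z - c)"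
    unfolding conjugate_def
  proof (rule SUP_least)
    fix w
    have "g w \<ge> ereal c + ereal (d \<bullet> (w - z))"
      using assms by (auto simp: subdiff_def)
    then show "ereal (d \<bullet> w) - g w \<le> ereal (d \<bullet> z - c)"
      by (cases "g w") (auto simp: inner_diff_right)
  qed
  show "ereal (d \<bullet> z - c) \<le> conjugate g d"
    using conjugate_ge[of d z g] assms by simp
qed

text \<open>If \<open>g z\<close> were \<open>\<infinity>\<close>, the subgradient inequality would
  make \<open>g\<close> infinite everywhere, against properness.\<close>

lemma finite_if_subdiff_nonempty:
  assumes "eproper g" and "subdiff g z \<noteq> {}"
  shows "\<bar>g z\<bar> \<noteq> \<infinity>"
proof -
  obtain d where d: "\<And>w. g w \<ge> g z + ereal (d \<bullet> (w - z))"
    using assms(2) by (auto simp: subdiff_def)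
  obtain w where "g w \<noteq> \<infinity>" using assms(1) by (auto simp: eproper_def)
  moreover have "g z \<noteq> -\<infinity>" using assms(1) by (auto simp: eproper_def)
  ultimately show ?thesis using d[of w] by auto
qed

section \<open>Identifying gradients\<close>

text \<open>The linearization error lies between 0 and a multiple of the squared distance, so after
  division by the distance it vanishes in the limit.\<close>

lemma GDERIV_quadratic_bound:
  fixes h :: "'a::real_inner \<Rightarrow> real"
  assumes lower: "\<And>v. h y + (v - y) \<bullet> D \<le> h v"
    and upper: "\<And>v. h v \<le> h y + (v - y) \<bullet> D + K * (norm (v - y))\<^sup>2"
  shows "GDERIV h y :> D"
proof -
  have "((\<lambda>v. (1 / norm (v - y)) *\<^sub>R (h v - (h y + (v - y) \<bullet> D))) \<longlongrightarrow> 0) (at y)"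
  proof (rule Lim_null_comparison)
    show "\<forall>\<^sub>F v in at y. norm ((1 / norm (v - y)) *\<^sub>R (h v - (h y + (v - y) \<bullet> D))) \<le> K * norm (v - y)"
    proof (rule eventually_at_filter[THEN iffD2, OF always_eventually], intro allI impI)
      fix v assume "v \<noteq> y"
      then show "norm ((1 / norm (v - y)) *\<^sub>R (h v - (h y + (v - y) \<bullet> D))) \<le> K * norm (v - y)"
        using lower[of v] upper[of v] by (simp add: field_simps power2_eq_square)
    qed
    have "((\<lambda>v. K * norm (v - y)) \<longlongrightarrow> K * norm (y - y)) (at y)"
      by (intro tendsto_intros)
    then show "((\<lambda>v. K * norm (v - y)) \<longlongrightarrow> 0) (at y)" by simp
  qed
  then show ?thesis
    unfolding gderiv_def has_derivative_at2 by (simp add: bounded_linear_inner_left)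
qed

lemma gradient_eqI:
  assumes "GDERIV h x :> D"
  shows "gradient h x = D"
  unfolding gradient_def
proof (rule the_equality)
  show "GDERIV h x :> D" by (rule assms)
next
  fix D' assume "GDERIV h x :> D'"
  with assms have "(\<lambda>h. h \<bullet> D) = (\<lambda>h. h \<bullet> D')"
    unfolding gderiv_def by (rule has_derivative_unique)
  then show "D' = D" by (metis inner_commute vector_eq_rdot)
qed

section \<open>The smooth dual term \<open>F\<close> and the map from dual to primal points\<close>

context
  fixes f :: "real^'n \<Rightarrow> ereal" and A :: "real^'n^'m" and \<sigma> :: real
  assumes f: "eproper f" "eclosed f" "strongly_econvex \<sigma> f" and \<sigma>: "\<sigma> > 0"
begin

text \<open>The maximizer defining x(y) minimizes \<open>f\<close> tilted by a linear term, which is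
  still \<open>\<sigma>\<close>-strongly convex, so it exists and the growth bound applies to
  it.\<close>

lemma primal_of_dual_growth:
  obtains c where "f (primal_of_dual f A y) = ereal c"
    and "dual_F f A y = ereal (y \<bullet> (A *v primal_of_dual f A y) - c)"
    and "\<And>z. ereal (c + y \<bullet> (A *v (z - primal_of_dual f A y))
           + \<sigma> / 2 * (norm (z - primal_of_dual f A y))\<^sup>2) \<le> f z"
proof -
  define s where "s = transpose A *v y"
  define h where "h = (\<lambda>x. f x + ereal (- (s \<bullet> x)))"
  define xm where "xm = primal_of_dual f A y"
  have s: "s \<bullet> x = y \<bullet> (A *v x)" for x
    by (simp add: s_def dot_lmul_matrix)
  have h: "eproper h" "eclosed h"
    unfolding h_def by (intro eproper_add_real eclosed_add_continuous f continuous_intros)+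
  have "strongly_econvex (\<sigma> + 0) h"
    unfolding h_def by (intro strongly_econvex_add f) (auto simp: inner_add_right algebra_simps)
  then have sc: "strongly_econvex \<sigma> h" by simp
  have conv: "ereal (s \<bullet> x) - f x = - h x" for x
    unfolding h_def by (cases "f x") auto
  obtain x0 where x0: "\<And>y. h x0 \<le> h y"
    using strongly_econvex_attains_min[OF h sc \<sigma>] by blast
  \<comment> \<open>\<open>arg_max\<close> is a choice operator; the witness \<open>x0\<close>
    guarantees that the chosen point is a maximizer.\<close>
  have "is_arg_max (\<lambda>x. ereal (s \<bullet> x) - f x) (\<lambda>_. True) xm"
    unfolding xm_def primal_of_dual_def s_def[symmetric] arg_max_def
    by (rule someI[of _ x0]) (use x0 in \<open>auto simp: is_arg_max_def conv not_less\<close>)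
  then have min: "h xm \<le> h z" for z
    by (auto simp: is_arg_max_def conv not_less)
  have "\<bar>h xm\<bar> \<noteq> \<infinity>"
    using \<open>eproper h\<close> min by (auto simp: eproper_def)
  then obtain c where c: "f xm = ereal c"
    unfolding h_def by (cases "f xm") auto
  then have hc: "h xm = ereal (c - s \<bullet> xm)"
    by (simp add: h_def)
  have "conjugate f s = ereal (s \<bullet> xm - c)"
  proof (rule antisym)
    show "conjugate f s \<le> ereal (s \<bullet> xm - c)"
      unfolding conjugate_def conv
    proof (rule SUP_least)
      fix z show "- h z \<le> ereal (s \<bullet> xm - c)"
        using min[of z] hc by (cases "h z") auto
    qed
    show "ereal (s \<bullet> xm - c) \<le> conjugate f s"
      using conjugate_ge[of s xm f] c by simp
  qed
  moreover have "ereal (c + s \<bullet> (z - xm) + \<sigma> / 2 * (norm (z - xm))\<^sup>2) \<le> f z" for z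
    using strongly_econvex_growth[OF h(1) sc min, of z] hc
    unfolding h_def by (cases "f z") (auto simp: inner_diff_right)
  ultimately show ?thesis
    using that[of c] c unfolding s dual_F_def s_def[symmetric] xm_def by blast
qed

text \<open>The operator norm enters twice, once in bounding the distance of the two primal points
  and once in applying \<open>A\<close> to it; hence its square in
  \<open>lipschitz_F\<close>.\<close>

lemma primal_of_dual_lipschitz:
  "norm (A *v primal_of_dual f A y - A *v primal_of_dual f A z) \<le> lipschitz_F \<sigma> A * norm (y - z)"
proof -
  define u where "u = primal_of_dual f A y"
  define v where "v = primal_of_dual f A z"
  define N where "N = onorm (\<lambda>x. A *v x)"
  have N: "norm (A *v x) \<le> N * norm x" for x
    unfolding N_def by (rule onorm) simp
  have "N \<ge> 0" unfolding N_def by (rule onorm_pos_le) simp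
  obtain a where a: "f u = ereal a" "\<And>w. ereal (a + y \<bullet> (A *v (w - u)) + \<sigma> / 2 * (norm (w - u))\<^sup>2) \<le> f w"
    using primal_of_dual_growth[of y] unfolding u_def by metis
  obtain b where b: "f v = ereal b" "\<And>w. ereal (b + z \<bullet> (A *v (w - v)) + \<sigma> / 2 * (norm (w - v))\<^sup>2) \<le> f w"
    using primal_of_dual_growth[of z] unfolding v_def by metis
  \<comment> \<open>Each growth inequality is tested at the other point. Adding them cancels
    \<open>a\<close> and \<open>b\<close>, and the two halves of \<open>\<sigma>\<close>
    combine.\<close>
  have "\<sigma> * (norm (u - v))\<^sup>2 \<le> (y - z) \<bullet> (A *v (u - v))"
    using a(2)[of v] b(2)[of u]
    by (simp add: a(1) b(1) matrix_vector_mult_diff_distrib inner_diff norm_minus_commute[of v u])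
  also have "\<dots> \<le> norm (y - z) * (N * norm (u - v))"
    by (intro order_trans[OF norm_cauchy_schwarz] mult_left_mono N) auto
  finally have "norm (u - v) * (\<sigma> * norm (u - v)) \<le> norm (u - v) * (N * norm (y - z))"
    by (simp add: power2_eq_square mult_ac)
  then have "norm (u - v) \<le> N * norm (y - z) / \<sigma>"
    using \<sigma> \<open>N \<ge> 0\<close> by (cases "u = v") (auto simp: field_simps)
  then have "N * norm (u - v) \<le> N * (N * norm (y - z) / \<sigma>)"
    using \<open>N \<ge> 0\<close> by (rule mult_left_mono)
  with N[of "u - v"] show ?thesis
    by (simp add: lipschitz_F_def N_def[symmetric] u_def[symmetric] v_def[symmetric]
        matrix_vector_mult_diff_distrib power2_eq_square)
qed

text \<open>The lower bound says that A x(y) is a subgradient of F at y. Exchanging the two points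
  and using the Lipschitz estimate gives the quadratic upper bound.\<close>

lemma gradient_dual_F:
  "gradient (\<lambda>v. real_of_ereal (dual_F f A v)) y = A *v primal_of_dual f A y"
proof (rule gradient_eqI, rule GDERIV_quadratic_bound)
  let ?x = "primal_of_dual f A"
  let ?F = "\<lambda>v. real_of_ereal (dual_F f A v)"
  have lower: "?F y + (v - y) \<bullet> (A *v ?x y) \<le> ?F v" for v y
  proof -
    obtain a where a: "f (?x y) = ereal a" "dual_F f A y = ereal (y \<bullet> (A *v ?x y) - a)"
      using primal_of_dual_growth[of y] by metis
    obtain b where b: "dual_F f A v = ereal (v \<bullet> (A *v ?x v) - b)"
      "ereal (b + v \<bullet> (A *v (?x y - ?x v)) + \<sigma> / 2 * (norm (?x y - ?x v))\<^sup>2) \<le> f (?x y)"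
      using primal_of_dual_growth[of v] by metis
    have "0 \<le> \<sigma> / 2 * (norm (?x y - ?x v))\<^sup>2" using \<sigma> by simp
    then show ?thesis
      using b(2) unfolding a b(1) by (simp add: matrix_vector_mult_diff_distrib inner_diff)
  qed
  show "?F y + (v - y) \<bullet> (A *v ?x y) \<le> ?F v" for v by (rule lower)
  show "?F v \<le> ?F y + (v - y) \<bullet> (A *v ?x y) + lipschitz_F \<sigma> A * (norm (v - y))\<^sup>2" for v
  proof -
    have "(v - y) \<bullet> (A *v ?x v - A *v ?x y) \<le> norm (v - y) * (lipschitz_F \<sigma> A * norm (v - y))"
      by (intro order_trans[OF norm_cauchy_schwarz] mult_left_mono primal_of_dual_lipschitz) auto
    then show ?thesis
      using lower[of v y] by (simp add: inner_diff power2_eq_square mult_ac)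
  qed
qed

end

section \<open>Optimality condition of the proximal gradient step\<close>

lemma strongly_convex_quadratic:
  fixes w y a :: "'a::real_inner" and L t :: real
  defines "q \<equiv> \<lambda>u. (u - y) \<bullet> a + L / 2 * (norm (u - y))\<^sup>2"
  shows "q (t *\<^sub>R u + (1 - t) *\<^sub>R v) = t * q u + (1 - t) * q v - L / 2 * t * (1 - t) * (norm (u - v))\<^sup>2"
proof -
  have 1: "t *\<^sub>R u + (1 - t) *\<^sub>R v - y = t *\<^sub>R (u - y) + (1 - t) *\<^sub>R (v - y)"
    by (simp add: algebra_simps)
  have 2: "u - v = (u - y) - (v - y)" by simp
  show ?thesis
    unfolding q_def 1 2 power2_norm_eq_inner
    by (simp only: inner_add inner_diff inner_scaleR_left inner_scaleR_right inner_commute[of "v - y" "u - y"])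
       (simp add: field_simps inner_commute)
qed

text \<open>The objective is \<open>L\<close>-strongly convex up to the constant \<open>c\<close>,
  so a minimizer exists. The conclusion is the first-order condition:
  \<open>- (a + L *\<^sub>R (p - y))\<close> is a subgradient of \<open>G\<close> at
  \<open>p\<close>.\<close>

lemma prox_optimality:
  fixes G :: "'a::euclidean_space \<Rightarrow> ereal" and L c :: real and y a :: 'a
  defines "p \<equiv> arg_min (\<lambda>u. ereal c + ereal ((u - y) \<bullet> a) + ereal (L / 2 * (norm (u - y))\<^sup>2) + G u) (\<lambda>_. True)"
  assumes G: "eproper G" "eclosed G" "strongly_econvex 0 G" and "L > 0"
  obtains b where "G p = ereal b" and "\<And>u. ereal (b - (a + L *\<^sub>R (p - y)) \<bullet> (u - p)) \<le> G u"
proof -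
  define q where "q = (\<lambda>u. (u - y) \<bullet> a + L / 2 * (norm (u - y))\<^sup>2)"
  define h where "h = (\<lambda>u. G u + ereal (q u))"
  have h: "eproper h" "eclosed h"
    unfolding h_def q_def by (intro eproper_add_real eclosed_add_continuous G continuous_intros)+
  have "strongly_econvex (0 + L) h"
    unfolding h_def q_def by (intro strongly_econvex_add G eq_refl strongly_convex_quadratic)
  then have sc: "strongly_econvex L h" by simp
  have obj: "ereal c + ereal ((u - y) \<bullet> a) + ereal (L / 2 * (norm (u - y))\<^sup>2) + G u = ereal c + h u" for u
    unfolding h_def q_def by (cases "G u") auto
  obtain u0 where u0: "\<And>u. h u0 \<le> h u"
    using strongly_econvex_attains_min[OF h sc \<open>L > 0\<close>] by blast
  have "is_arg_min (\<lambda>u. ereal c + h u) (\<lambda>_. True) p"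
    unfolding p_def obj arg_min_def
    by (rule someI[of _ u0]) (use u0 in \<open>auto simp: is_arg_min_linorder intro: add_left_mono\<close>)
  then have min: "h p \<le> h u" for u
    by (auto simp: is_arg_min_linorder ereal_add_le_add_iff)
  have "\<bar>h p\<bar> \<noteq> \<infinity>"
    using \<open>eproper h\<close> min by (auto simp: eproper_def)
  then obtain b where b: "G p = ereal b"
    unfolding h_def by (cases "G p") auto
  have "ereal (b - (a + L *\<^sub>R (p - y)) \<bullet> (u - p)) \<le> G u" for u
  proof -
    have "(norm (r + s))\<^sup>2 = (norm r)\<^sup>2 + 2 * (r \<bullet> s) + (norm s)\<^sup>2" for r s :: 'a
      by (simp add: power2_norm_eq_inner inner_add inner_commute)
    from this[of "u - p" "p - y"] have "(norm (u - y))\<^sup>2 = (norm (u - p))\<^sup>2 + 2 * ((u - p) \<bullet> (p - y)) + (norm (p - y))\<^sup>2"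
      by simp
    then have "L / 2 * (norm (u - y))\<^sup>2
        = L / 2 * (norm (u - p))\<^sup>2 + L * ((u - p) \<bullet> (p - y)) + L / 2 * (norm (p - y))\<^sup>2"
      by (simp only: distrib_left)
    \<comment> \<open>The second-order term in this exact expansion equals the growth term of
      \<open>h\<close> at \<open>p\<close>; the two cancel and leave a linear bound on
      \<open>G\<close>.\<close>
    then have "q u = q p + (a + L *\<^sub>R (p - y)) \<bullet> (u - p) + L / 2 * (norm (u - p))\<^sup>2"
      by (simp add: q_def inner_diff inner_add inner_commute right_diff_distrib)
    then show ?thesis
      using strongly_econvex_growth[OF h(1) sc min, of u]
      unfolding h_def b by (cases "G u") auto
  qed
  with b show ?thesis by (rule that)
qed

section \<open>The dual term \<open>G\<close> and weak duality\<close>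

text \<open>A subgradient \<open>d\<close> of \<open>g\<close> makes the conjugate finite at
  \<open>d\<close>, hence \<open>G\<close> finite at \<open>- d\<close>. Closedness and convexity
  carry over from the conjugate by reflection.\<close>

lemma dual_G_regular:
  fixes g :: "real^'m \<Rightarrow> ereal"
  assumes "eproper g" and "subdiff g z \<noteq> {}"
  shows "eproper (dual_G g)" and "eclosed (dual_G g)" and "strongly_econvex 0 (dual_G g)"
proof -
  obtain d c where "d \<in> subdiff g z" "g z = ereal c"
    using assms finite_if_subdiff_nonempty[OF assms] by (cases "g z") auto
  then have "dual_G g (- d) \<noteq> \<infinity>"
    by (simp add: dual_G_def conjugate_subgradient)
  then show "eproper (dual_G g)"
    unfolding eproper_def dual_G_def using conjugate_neq_MInf[OF assms(1)] by blast
  have "eepigraph (dual_G g) = (\<lambda>(u, t). (- u, t)) -` eepigraph (conjugate g)"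
    by (auto simp: eepigraph_def dual_G_def)
  moreover have "continuous_on UNIV (\<lambda>(u :: real^'m, t :: real). (- u, t))"
    by (auto simp: case_prod_unfold intro!: continuous_intros)
  ultimately show "eclosed (dual_G g)"
    using eclosed_conjugate[OF assms(1)] by (auto simp: eclosed_def intro: closed_vimage)
  show "strongly_econvex 0 (dual_G g)"
    unfolding strongly_econvex_def dual_G_def
  proof (intro allI ballI)
    fix u v :: "real^'m" and t :: real
    assume t: "t \<in> {0..1}"
    have "- (t *\<^sub>R u + (1 - t) *\<^sub>R v) = t *\<^sub>R (- u) + (1 - t) *\<^sub>R (- v)"
      by simp
    then show "conjugate g (- (t *\<^sub>R u + (1 - t) *\<^sub>R v))
        \<le> ereal t * conjugate g (- u) + ereal (1 - t) * conjugate g (- v)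
          - ereal (0 / 2 * t * (1 - t) * (norm (u - v))\<^sup>2)"
      using strongly_econvex_conjugate[OF assms(1)] t
      unfolding strongly_econvex_def by (metis div_0 mult_zero_left)
  qed
qed

text \<open>Sum of two Fenchel-Young inequalities. The gap subtracts the dual value, so bounding it
  from above calls for this lower bound.\<close>

lemma weak_duality:
  assumes "eproper f" and "eproper g"
    and F: "dual_F f A y = ereal a" and G: "dual_G g y = ereal b"
  shows "ereal (- a - b) \<le> dual_obj f g A y"
  unfolding dual_obj_def
proof (intro INF_greatest)
  fix x z
  have "ereal (y \<bullet> (A *v x)) \<le> f x + ereal a"
    using fenchel_young[OF \<open>eproper f\<close>, of "transpose A *v y" x] F
    by (simp add: dual_F_def dot_lmul_matrix)
  moreover have "ereal (- (y \<bullet> z)) \<le> g z + ereal b"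
    using fenchel_young[OF \<open>eproper g\<close>, of "- y" z] G by (simp add: dual_G_def)
  ultimately show "ereal (- a - b) \<le> f x + g z - ereal (y \<bullet> (A *v x - z))"
    by (cases "f x"; cases "g z") (auto simp: inner_diff_right)
qed

section \<open>The bound on the primal-dual gap\<close>

lemma subgrad_bound_upper:
  assumes "d \<in> subdiff g z"
  shows "ereal (norm d) \<le> subgrad_bound g"
  unfolding subgrad_bound_def using assms by (meson SUP_upper2 SUP_upper UNIV_I)

theorem lemma4p4:
  fixes f :: "real^'n \<Rightarrow> ereal" and g :: "real^'m \<Rightarrow> ereal"
    and A :: "real^'n^'m" and \<sigma> L :: real and y :: "real^'m"
  assumes "eproper f" and "eclosed f" and "econvex f"
    and "eproper g" and "eclosed g" and "econvex g"
    and "\<sigma> > 0" and "strongly_econvex \<sigma> f"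
    and "\<And>z. subdiff g z \<noteq> {}"
    and "subgrad_bound g < \<infinity>"
    and "L > 0"
  shows "primal_obj f g A (primal_of_dual f A (prox_grad_map f g A L y))
           - dual_obj f g A (prox_grad_map f g A L y)
         \<le> ereal (L + lipschitz_F \<sigma> A)
             * (ereal (norm (prox_grad_map f g A L y)) + subgrad_bound g)
             * ereal (norm (prox_grad_map f g A L y - y))"
proof -
  define p where "p = prox_grad_map f g A L y"
  define xp where "xp = primal_of_dual f A p"
  define xy where "xy = primal_of_dual f A y"
  define v where "v = A *v xy + L *\<^sub>R (p - y)"
  note f = \<open>eproper f\<close> \<open>eclosed f\<close> \<open>strongly_econvex \<sigma> f\<close> \<open>\<sigma> > 0\<close>
  note subdiff = \<open>\<And>z. subdiff g z \<noteq> {}\<close>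
  have g_real: "\<exists>c. g z = ereal c" for z
    using finite_if_subdiff_nonempty[OF \<open>eproper g\<close> subdiff] by (metis ereal_real')
  \<comment> \<open>Any one subgradient shows that the supremum of norms is not
    \<open>-\<infinity>\<close> and that \<open>\<gamma> \<ge> 0\<close>.\<close>
  obtain d0 where d0: "d0 \<in> subdiff g 0" using subdiff by blast
  obtain \<gamma> where \<gamma>: "subgrad_bound g = ereal \<gamma>"
    using subgrad_bound_upper[OF d0] \<open>subgrad_bound g < \<infinity>\<close> by (cases "subgrad_bound g") auto
  have \<gamma>_upper: "norm d \<le> \<gamma>" if "d \<in> subdiff g z" for d z
    using subgrad_bound_upper[OF that] \<gamma> by simp
  have "\<gamma> \<ge> 0" using \<gamma>_upper[OF d0] norm_ge_zero order_trans by blast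

  obtain c where c: "f xp = ereal c" "dual_F f A p = ereal (p \<bullet> (A *v xp) - c)"
    using primal_of_dual_growth[OF f, of A p] unfolding xp_def by metis
  obtain Fy where Fy: "dual_F f A y = ereal Fy"
    using primal_of_dual_growth[OF f, of A y] by metis
  \<comment> \<open>Replacing the gradient by \<open>A *v xy\<close> and the value of F at
    \<open>y\<close> by a real constant gives the form that \<open>prox_optimality\<close>
    treats.\<close>
  have p_eq: "p = arg_min (\<lambda>u. ereal Fy + ereal ((u - y) \<bullet> (A *v xy))
      + ereal (L / 2 * (norm (u - y))\<^sup>2) + dual_G g u) (\<lambda>_. True)"
    unfolding p_def prox_grad_map_def gradient_dual_F[OF f] Fy xy_def ..
  obtain b where b: "dual_G g p = ereal b" "\<And>u. ereal (b - v \<bullet> (u - p)) \<le> dual_G g u"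
    using prox_optimality[OF dual_G_regular[OF \<open>eproper g\<close> subdiff] \<open>L > 0\<close>,
        where a = "A *v xy" and y = y and c = Fy]
    unfolding p_eq[symmetric] v_def by metis

  obtain e where e: "g v = ereal e" using g_real by blast
  obtain e' where e': "g (A *v xp) = ereal e'" using g_real by blast
  text \<open>The optimality condition says \<open>v \<in> \<partial>g\<^sup>*(-p)\<close>; testing it at a subgradient \<open>d\<close> of \<open>g\<close> at
    \<open>v\<close>, where \<open>g\<^sup>*(d)\<close> is known, gives \<open>-p \<in> \<partial>g(v)\<close> without biconjugation.\<close>
  obtain d where d: "d \<in> subdiff g v" using subdiff by blast
  have "b \<le> - (p \<bullet> v) - e"
    using b(2)[of "- d"] conjugate_subgradient[OF e d]
    by (simp add: dual_G_def inner_diff_right inner_commute)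
  moreover have "e' - e \<le> \<gamma> * norm (A *v xp - v)"
  proof -
    \<comment> \<open>A subgradient at \<open>A *v xp\<close>, rather than at \<open>v\<close>,
      bounds \<open>e' - e\<close> from above.\<close>
    obtain d' where d': "d' \<in> subdiff g (A *v xp)" using subdiff by blast
    then have "g v \<ge> g (A *v xp) + ereal (d' \<bullet> (v - A *v xp))"
      by (auto simp: subdiff_def)
    then have "e' - e \<le> d' \<bullet> (A *v xp - v)"
      by (simp add: e e' inner_diff_right)
    also have "\<dots> \<le> norm d' * norm (A *v xp - v)" by (rule norm_cauchy_schwarz)
    also have "\<dots> \<le> \<gamma> * norm (A *v xp - v)"
      by (intro mult_right_mono \<gamma>_upper[OF d']) simp
    finally show ?thesis .
  qed
  moreover have "p \<bullet> (A *v xp) - p \<bullet> v \<le> norm p * norm (A *v xp - v)"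
    using norm_cauchy_schwarz[of p "A *v xp - v"] by (simp add: inner_diff_right)
  ultimately have "e' + p \<bullet> (A *v xp) + b \<le> (norm p + \<gamma>) * norm (A *v xp - v)"
    by (simp add: distrib_right)
  also have "norm (A *v xp - v) \<le> (L + lipschitz_F \<sigma> A) * norm (p - y)"
  proof -
    have "norm (A *v xp - v) \<le> norm (A *v xp - A *v xy) + norm (L *\<^sub>R (p - y))"
      unfolding v_def by (metis diff_diff_eq norm_triangle_ineq4)
    also have "\<dots> \<le> lipschitz_F \<sigma> A * norm (p - y) + L * norm (p - y)"
      unfolding xp_def xy_def using primal_of_dual_lipschitz[OF f] \<open>L > 0\<close> by (intro add_mono) auto
    finally show ?thesis by (simp add: algebra_simps)
  qed
  then have "(norm p + \<gamma>) * norm (A *v xp - v)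
      \<le> (norm p + \<gamma>) * ((L + lipschitz_F \<sigma> A) * norm (p - y))"
    using \<open>\<gamma> \<ge> 0\<close> by (intro mult_left_mono) auto
  finally have "e' + p \<bullet> (A *v xp) + b \<le> (L + lipschitz_F \<sigma> A) * (norm p + \<gamma>) * norm (p - y)"
    by (simp add: mult_ac)
  \<comment> \<open>The primal value is \<open>c + e'\<close> and the dual value is at least
    \<open>c - p \<bullet> (A *v xp) - b\<close>, so \<open>c\<close> cancels.\<close>
  moreover have "primal_obj f g A xp - dual_obj f g A p \<le> ereal (e' + p \<bullet> (A *v xp) + b)"
    using weak_duality[OF \<open>eproper f\<close> \<open>eproper g\<close> c(2) b(1)]
    by (cases "dual_obj f g A p") (auto simp: primal_obj_def c(1) e')
  ultimately have "primal_obj f g A xp - dual_obj f g A p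
      \<le> ereal ((L + lipschitz_F \<sigma> A) * (norm p + \<gamma>) * norm (p - y))"
    using order_trans ereal_less_eq(3) by blast
  then show ?thesis
    by (simp add: p_def[symmetric] xp_def[symmetric] \<gamma>)
qed

end
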